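(* $(CP_1)$ is a valid formulation of the $p$-center problem. That is, for every instance of the $p$-center problem, the optimal value of $(CP_1)$ equals the optimal radius, and for every optimal solution $(y,z)$ of $(CP_1)$ the set of facilities $\{F_j : y_j=1\}$ is an optimal solution of the $p$-center problem.
   Context: An instance of the $p$-center problem consists of positive integers $N$ (number of clients $C_1,\dots,C_N$), $M$ (number of potential facility sites $F_1,\dots,F_M$) and $p$, and of distances $d_{ij}\ge 0$ between client $C_i$ and site $F_j$ for $i\in\mathcal N=\{1,\dots,N\}$, $j\in\mathcal M=\{1,\dots,M\}$. The problem is to choose a nonempty set $J\subseteq\mathcal M$ of at most $p$ open sites minimizing the radius $\max_{i\in\mathcal N}\min_{j\in J} d_{ij}$; the minimum is called the optimal radius. Let $D^0<D^1<\dots<D^K$ be the distinct values taken by the $d_{ij}$, with $K\ge 1$, and $\mathcal K=\{1,\dots,K\}$. For $i\in\mathcal N$ and $k\in\mathcal K$, let $N_i^k$ be the set of facilities located at distance less than $D^k$ from client $C_i$, i.e. those with $d_{ij}<D^k$. Let $S_i$ be the set of indices $k\in\{1,\dots,K-1\}$ such that $N_i^k\ne N_i^{k+1}$. Formulation $(CP_1)$ is the 0-1 program with variables $y_j$ ($j\in\mathcal M$) and $z^k$ ($k\in\mathcal K$): $$\min\ D^0+\sum_{k=1}^K (D^k-D^{k-1})\,z^k$$ subject to $$1\le \sum_{j=1}^M y_j\le p,\qquad z^k\ge z^{k+1}\quad (k\in\{1,\dots,K-1\}),$$ $$z^k+\sum_{j\,:\,d_{ij}<D^k} y_j\ge 1\quad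 (i\in\mathcal N,\ k\in S_i\cup\{K\}),\qquad y_j,z^k\in\{0,1\}\quad (j\in\mathcal M,\ k\in\mathcal K).$$ *)

theory Defs
  imports Complex_Main "HOL-Library.FuncSet"
begin

text \<open>Clients are \<open>1, \<dots>, N\<close>, sites are \<open>1, \<dots>, M\<close>, and \<open>d i j\<close> is the distance
  between client \<open>i\<close> and site \<open>j\<close>.\<close>

definition pcenter_feasible :: "nat \<Rightarrow> nat \<Rightarrow> nat set set" where
  "pcenter_feasible M p = {J. J \<subseteq> {1..M} \<and> J \<noteq> {} \<and> card J \<le> p}"

definition radius :: "nat \<Rightarrow> (nat \<Rightarrow> nat \<Rightarrow> real) \<Rightarrow> nat set \<Rightarrow> real" where
  "radius N d J = Max ((\<lambda>i. Min ((\<lambda>j. d i j) ` J)) ` {1..N})"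

definition optimal_radius :: "nat \<Rightarrow> nat \<Rightarrow> nat \<Rightarrow> (nat \<Rightarrow> nat \<Rightarrow> real) \<Rightarrow> real" where
  "optimal_radius N M p d = Min (radius N d ` pcenter_feasible M p)"

definition pcenter_optimal :: "nat \<Rightarrow> nat \<Rightarrow> nat \<Rightarrow> (nat \<Rightarrow> nat \<Rightarrow> real) \<Rightarrow> nat set \<Rightarrow> bool" where
  "pcenter_optimal N M p d J \<longleftrightarrow> is_arg_min (radius N d) (\<lambda>J. J \<in> pcenter_feasible M p) J"

lemma finite_pcenter_feasible: "finite (pcenter_feasible M p)"
  by (rule finite_subset[of _ "Pow {1..M}"]) (auto simp: pcenter_feasible_def)

lemma pcenter_feasible_nonempty:
  assumes "M \<ge> 1" "p \<ge> 1"
  shows "pcenter_feasible M p \<noteq> {}"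
proof -
  have "{1} \<in> pcenter_feasible M p"
    using assms by (auto simp: pcenter_feasible_def)
  then show ?thesis by blast
qed

definition dist_values :: "nat \<Rightarrow> nat \<Rightarrow> (nat \<Rightarrow> nat \<Rightarrow> real) \<Rightarrow> real set" where
  "dist_values N M d = {d i j | i j. i \<in> {1..N} \<and> j \<in> {1..M}}"

text \<open>The distinct distances in increasing order are \<open>D 0 < D 1 < \<dots> < D K\<close>, so that there are
  \<open>K + 1\<close> of them; see the lemmas below.\<close>

definition distK :: "nat \<Rightarrow> nat \<Rightarrow> (nat \<Rightarrow> nat \<Rightarrow> real) \<Rightarrow> nat" where
  "distK N M d = card (dist_values N M d) - 1"

definition distD :: "nat \<Rightarrow> nat \<Rightarrow> (nat \<Rightarrow> nat \<Rightarrow> real) \<Rightarrow> nat \<Rightarrow> real" where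
  "distD N M d k = sorted_list_of_set (dist_values N M d) ! k"

lemma finite_dist_values: "finite (dist_values N M d)"
proof -
  have "dist_values N M d = (\<lambda>(i, j). d i j) ` ({1..N} \<times> {1..M})"
    by (auto simp: dist_values_def) blast
  then show ?thesis by simp
qed

lemma card_dist_values:
  assumes "N \<ge> 1" "M \<ge> 1"
  shows "card (dist_values N M d) = Suc (distK N M d)"
proof -
  have "d 1 1 \<in> dist_values N M d"
    using assms by (auto simp: dist_values_def)
  then have "card (dist_values N M d) > 0"
    using finite_dist_values card_gt_0_iff by blast
  then show ?thesis by (simp add: distK_def)
qed

lemma distD_strict_mono:
  assumes "N \<ge> 1" "M \<ge> 1"
  shows "strict_mono_on {0..distK N M d} (distD N M d)"
proof (rule strict_mono_onI)
  fix r s assume "r \<in> {0..distK N M d}" "s \<in> {0..distK N M d}" "r < s"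
  then show "distD N M d r < distD N M d s"
    using card_dist_values[OF assms, of d]
      strict_sorted_list_of_set[of "dist_values N M d"]
    by (simp add: distD_def sorted_wrt_iff_nth_less)
qed

lemma distD_image:
  assumes "N \<ge> 1" "M \<ge> 1"
  shows "distD N M d ` {0..distK N M d} = dist_values N M d"
proof -
  let ?xs = "sorted_list_of_set (dist_values N M d)"
  have "{0..distK N M d} = {0..<length ?xs}"
    using card_dist_values[OF assms, of d] by auto
  then have "distD N M d ` {0..distK N M d} = set ?xs"
    by (auto simp: distD_def set_conv_nth)
  then show ?thesis by (simp add: finite_dist_values)
qed

definition near_sites ::
  "nat \<Rightarrow> nat \<Rightarrow> (nat \<Rightarrow> nat \<Rightarrow> real) \<Rightarrow> nat \<Rightarrow> nat \<Rightarrow> nat set" where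
  "near_sites N M d i k = {j \<in> {1..M}. d i j < distD N M d k}"

definition change_indices ::
  "nat \<Rightarrow> nat \<Rightarrow> (nat \<Rightarrow> nat \<Rightarrow> real) \<Rightarrow> nat \<Rightarrow> nat set" where
  "change_indices N M d i =
     {k \<in> {1..distK N M d - 1}. near_sites N M d i k \<noteq> near_sites N M d i (k + 1)}"

text \<open>The variables are extensional functions on their index sets, which makes the set of feasible
  solutions finite.\<close>

definition CP1_feasible ::
  "nat \<Rightarrow> nat \<Rightarrow> nat \<Rightarrow> (nat \<Rightarrow> nat \<Rightarrow> real) \<Rightarrow> ((nat \<Rightarrow> real) \<times> (nat \<Rightarrow> real)) set" where
  "CP1_feasible N M p d = {(y, z).
     y \<in> {1..M} \<rightarrow>\<^sub>E {0, 1} \<and>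
     z \<in> {1..distK N M d} \<rightarrow>\<^sub>E {0, 1} \<and>
     1 \<le> (\<Sum>j=1..M. y j) \<and> (\<Sum>j=1..M. y j) \<le> real p \<and>
     (\<forall>k\<in>{1..distK N M d - 1}. z k \<ge> z (k + 1)) \<and>
     (\<forall>i\<in>{1..N}. \<forall>k\<in>change_indices N M d i \<union> {distK N M d}.
        z k + (\<Sum>j\<in>near_sites N M d i k. y j) \<ge> 1)}"

definition CP1_objective ::
  "nat \<Rightarrow> nat \<Rightarrow> (nat \<Rightarrow> nat \<Rightarrow> real) \<Rightarrow> (nat \<Rightarrow> real) \<times> (nat \<Rightarrow> real) \<Rightarrow> real" where
  "CP1_objective N M d = (\<lambda>(y, z).
     distD N M d 0 + (\<Sum>k=1..distK N M d. (distD N M d k - distD N M d (k - 1)) * z k))"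

definition CP1_value :: "nat \<Rightarrow> nat \<Rightarrow> nat \<Rightarrow> (nat \<Rightarrow> nat \<Rightarrow> real) \<Rightarrow> real" where
  "CP1_value N M p d = Min (CP1_objective N M d ` CP1_feasible N M p d)"

definition CP1_optimal ::
  "nat \<Rightarrow> nat \<Rightarrow> nat \<Rightarrow> (nat \<Rightarrow> nat \<Rightarrow> real) \<Rightarrow> (nat \<Rightarrow> real) \<Rightarrow> (nat \<Rightarrow> real) \<Rightarrow> bool" where
  "CP1_optimal N M p d y z \<longleftrightarrow>
     is_arg_min (CP1_objective N M d) (\<lambda>s. s \<in> CP1_feasible N M p d) (y, z)"

lemma finite_CP1_feasible: "finite (CP1_feasible N M p d)"
proof (rule finite_subset)
  show "CP1_feasible N M p d \<subseteq>
      ({1..M} \<rightarrow>\<^sub>E {0, 1}) \<times> ({1..distK N M d} \<rightarrow>\<^sub>E {0, 1})"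
    by (auto simp: CP1_feasible_def)
  show "finite (({1..M} \<rightarrow>\<^sub>E {0, 1 :: real}) \<times> ({1..distK N M d} \<rightarrow>\<^sub>E {0, 1 :: real}))"
    by (intro finite_cartesian_product finite_PiE) auto
qed

lemma CP1_feasible_nonempty:
  assumes "M \<ge> 1" "p \<ge> 1" "distK N M d \<ge> 1"
  shows "CP1_feasible N M p d \<noteq> {}"
proof -
  let ?y = "\<lambda>j\<in>{1..M}. if j = 1 then 1 else 0 :: real"
  let ?z = "\<lambda>k\<in>{1..distK N M d}. 1 :: real"
  have s: "(\<Sum>j=1..M. ?y j) = 1"
    using assms(1) by (simp add: sum.delta)
  have n: "(\<Sum>j\<in>near_sites N M d i k. ?y j) \<ge> 0" for i k
    by (rule sum_nonneg) (auto simp: near_sites_def)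
  have k: "?z k = 1" if "k \<in> change_indices N M d i \<union> {distK N M d}" for i k
    using that assms(3) by (auto simp: change_indices_def)
  have "1 \<le> ?z k + (\<Sum>j\<in>near_sites N M d i k. ?y j)"
    if "k \<in> change_indices N M d i \<union> {distK N M d}" for i k
    using k[OF that] n[of i k] by linarith
  moreover have "?y \<in> {1..M} \<rightarrow>\<^sub>E {0, 1}" "?z \<in> {1..distK N M d} \<rightarrow>\<^sub>E {0, 1}"
    by auto
  moreover have "\<forall>k\<in>{1..distK N M d - 1}. ?z k \<ge> ?z (k + 1)"
    by auto
  ultimately have "(?y, ?z) \<in> CP1_feasible N M p d"
    unfolding CP1_feasible_def mem_Collect_eq case_prod_conv s
    using assms(2) by (intro conjI ballI) auto
  then show ?thesis by blast
qed

end

(* From a feasible (y, z), let J be the set of open sites and D^m its radius, attained at client i.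
   No open site lies in N_i^m; the last index k with N_i^k = N_i^m belongs to S_i or equals K, so its
   covering constraint forces z^k = 1, and monotonicity gives z^l = 1 for all l <= m.  The objective
   then telescopes to at least D^m.  Conversely, J together with z^k = 1 iff D^k <= radius J is
   feasible and its objective telescopes to the radius. *)
theory Submission
  imports Defs
begin

text \<open>Each problem dominates the other: \<open>g\<close> maps solutions of the first to
  solutions of the second that are no worse, and \<open>up\<close> goes back. A minimiser
  \<open>s\<close> is carried to a minimiser because every \<open>t\<close> has some
  \<open>s'\<close> in \<open>A\<close> with h (g s) <= f s <= f s' <= h t.\<close>

lemma min_problem_transfer:
  fixes f :: "'a \<Rightarrow> 'c::linorder" and h :: "'b \<Rightarrow> 'c"
  assumes fin: "finite A" "finite B" and "A \<noteq> {}"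
    and down: "\<And>s. s \<in> A \<Longrightarrow> g s \<in> B \<and> h (g s) \<le> f s"
    and up: "\<And>t. t \<in> B \<Longrightarrow> \<exists>s\<in>A. f s \<le> h t"
  shows "Min (f ` A) = Min (h ` B)"
    and "is_arg_min f (\<lambda>s. s \<in> A) s \<Longrightarrow> is_arg_min h (\<lambda>t. t \<in> B) (g s)"
proof -
  have "B \<noteq> {}" using down \<open>A \<noteq> {}\<close> by blast
  show "Min (f ` A) = Min (h ` B)"
  proof (rule antisym)
    show "Min (f ` A) \<le> Min (h ` B)"
      using fin \<open>A \<noteq> {}\<close> \<open>B \<noteq> {}\<close> up by (simp add: Min_le_iff)
    show "Min (h ` B) \<le> Min (f ` A)"
      using fin \<open>A \<noteq> {}\<close> \<open>B \<noteq> {}\<close> down by (auto simp: Min_le_iff)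
  qed
  show "is_arg_min h (\<lambda>t. t \<in> B) (g s)" if "is_arg_min f (\<lambda>s. s \<in> A) s"
    using that down up unfolding is_arg_min_linorder by (meson order_trans)
qed

lemma radius_witness:
  assumes "N \<ge> 1" "J \<in> pcenter_feasible M p"
  obtains i j where "i \<in> {1..N}" "j \<in> J" "radius N d J = d i j" "\<And>j'. j' \<in> J \<Longrightarrow> d i j \<le> d i j'"
proof -
  have J: "finite J" "J \<noteq> {}"
    using assms(2) by (auto simp: pcenter_feasible_def intro: finite_subset)
  have "radius N d J \<in> (\<lambda>i. Min ((\<lambda>j. d i j) ` J)) ` {1..N}"
    unfolding radius_def using assms(1) by (intro Max_in) auto
  then obtain i where i: "i \<in> {1..N}" "radius N d J = Min ((\<lambda>j. d i j) ` J)" by blast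
  moreover have "Min ((\<lambda>j. d i j) ` J) \<in> (\<lambda>j. d i j) ` J"
    using J by (intro Min_in) auto
  then obtain j where "j \<in> J" "Min ((\<lambda>j. d i j) ` J) = d i j" by blast
  moreover have "Min ((\<lambda>j. d i j) ` J) \<le> d i j'" if "j' \<in> J" for j'
    using J that by simp
  ultimately show thesis using that by metis
qed

lemma radius_covers:
  assumes "i \<in> {1..N}" "J \<in> pcenter_feasible M p"
  obtains j where "j \<in> J" "d i j \<le> radius N d J"
proof -
  have J: "finite J" "J \<noteq> {}"
    using assms(2) by (auto simp: pcenter_feasible_def intro: finite_subset)
  have "Min ((\<lambda>j. d i j) ` J) \<in> (\<lambda>j. d i j) ` J"
    using J by (intro Min_in) auto
  moreover have "Min ((\<lambda>j. d i j) ` J) \<le> radius N d J"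
    unfolding radius_def using assms(1) by (intro Max_ge) auto
  ultimately show thesis using that by auto
qed

text \<open>The maximum and minimum in the radius are attained, so the radius is itself a distance.
  The index \<open>m\<close> obtained here is the threshold at which \<open>z\<close> is compared or
  cut off below.\<close>

lemma radius_eq_distD:
  assumes "N \<ge> 1" "M \<ge> 1" "J \<in> pcenter_feasible M p"
  obtains m where "m \<le> distK N M d" "radius N d J = distD N M d m"
proof -
  obtain i j where "i \<in> {1..N}" "j \<in> J" "radius N d J = d i j"
    using radius_witness[OF assms(1,3)] by metis
  moreover have "J \<subseteq> {1..M}" using assms(3) by (simp add: pcenter_feasible_def)
  ultimately have "radius N d J \<in> dist_values N M d"
    unfolding dist_values_def by blast
  then show thesis using that distD_image[OF assms(1,2), of d] by force
qed

lemma distD_le_iff: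
  assumes "N \<ge> 1" "M \<ge> 1" "k \<le> distK N M d" "l \<le> distK N M d"
  shows "distD N M d k \<le> distD N M d l \<longleftrightarrow> k \<le> l"
  using strict_mono_on_less_eq[OF distD_strict_mono[OF assms(1,2), of d], of k l] assms(3,4) by simp

lemma CP1_objective_threshold:
  assumes "m \<le> distK N M d"
    and one: "\<And>k. k \<in> {1..m} \<Longrightarrow> z k = 1"
    and zero: "\<And>k. k \<in> {m<..distK N M d} \<Longrightarrow> z k = 0"
  shows "CP1_objective N M d (y, z) = distD N M d m"
proof -
  let ?D = "distD N M d"
  have "(\<Sum>k=1..distK N M d. (?D k - ?D (k - 1)) * z k) = (\<Sum>k=1..m. ?D k - ?D (k - 1))"
    using assms by (intro sum.mono_neutral_cong_right) auto
  also have "\<dots> = ?D m - ?D 0"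
    using sum_telescope''[of 0 m ?D] by simp
  finally show ?thesis by (simp add: CP1_objective_def)
qed

text \<open>The coefficients D^k - D^(k-1) are nonnegative, so the objective is monotone in
  \<open>z\<close>, and it suffices to compare with a threshold vector.\<close>

lemma CP1_objective_ge:
  assumes "N \<ge> 1" "M \<ge> 1" "m \<le> distK N M d"
    and one: "\<And>k. k \<in> {1..m} \<Longrightarrow> z k = 1"
    and nonneg: "\<And>k. k \<in> {1..distK N M d} \<Longrightarrow> z k \<ge> 0"
  shows "distD N M d m \<le> CP1_objective N M d (y, z)"
proof -
  let ?D = "distD N M d"
  \<comment> \<open>The pointwise least nonnegative vector that is 1 on {1..m}. It may take any
    value outside {1..K}, since the objective reads only those indices.\<close>
  let ?z = "\<lambda>k. if k \<le> m then 1 else 0 :: real"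
  have "?D m = CP1_objective N M d (y, ?z)"
    using assms(3) by (intro CP1_objective_threshold[symmetric]) auto
  also have "\<dots> \<le> CP1_objective N M d (y, z)"
    unfolding CP1_objective_def case_prod_conv
  proof (intro add_left_mono sum_mono mult_left_mono)
    fix k assume k: "k \<in> {1..distK N M d}"
    then show "?z k \<le> z k" using one nonneg by simp
    show "0 \<le> ?D k - ?D (k - 1)"
      using distD_le_iff[OF assms(1,2), of "k - 1" d k] k by (simp add: le_diff_conv)
  qed
  finally show ?thesis .
qed

lemma sum_binary_eq_card:
  fixes y :: "'a \<Rightarrow> real"
  assumes "finite A" "\<And>j. j \<in> A \<Longrightarrow> y j \<in> {0, 1}"
  shows "(\<Sum>j\<in>A. y j) = card {j \<in> A. y j = 1}"
proof -
  have "(\<Sum>j\<in>A. y j) = (\<Sum>j\<in>{j \<in> A. y j = 1}. 1)"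
    using assms by (intro sum.mono_neutral_cong_right) auto
  then show ?thesis by simp
qed

lemma open_sites_feasible:
  assumes "(y, z) \<in> CP1_feasible N M p d"
  shows "{j \<in> {1..M}. y j = 1} \<in> pcenter_feasible M p"
proof -
  have y: "y \<in> {1..M} \<rightarrow>\<^sub>E {0, 1}" and s: "1 \<le> (\<Sum>j=1..M. y j)" "(\<Sum>j=1..M. y j) \<le> real p"
    using assms by (auto simp: CP1_feasible_def)
  have "(\<Sum>j=1..M. y j) = card {j \<in> {1..M}. y j = 1}"
    using y by (intro sum_binary_eq_card) auto
  then have card: "1 \<le> card {j \<in> {1..M}. y j = 1}" "card {j \<in> {1..M}. y j = 1} \<le> p"
    using s by simp_all
  then have "{j \<in> {1..M}. y j = 1} \<noteq> {}"
    by (metis card.empty not_one_le_zero)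
  with card(2) show ?thesis
    unfolding pcenter_feasible_def by blast
qed

text \<open>The program may have no covering constraint for client \<open>i\<close> at index
  \<open>m\<close> itself, so one is borrowed from a later index with the same near set and its
  effect is carried down by monotonicity of \<open>z\<close>.\<close>

lemma uncovered_forces_one:
  assumes feas: "(y, z) \<in> CP1_feasible N M p d"
    and i: "i \<in> {1..N}" and m: "m \<le> distK N M d" "k \<in> {1..m}"
    and uncovered: "\<And>j. j \<in> near_sites N M d i m \<Longrightarrow> y j = 0"
  shows "z k = 1"
proof -
  let ?K = "distK N M d" and ?n = "near_sites N M d i"
  \<comment> \<open>The last index whose near set is still that of \<open>m\<close>: either it is K
    or the near set changes right after it, so a constraint exists there.\<close>
  define k' where "k' = Max {l \<in> {m..?K}. ?n l = ?n m}"
  have "k' \<in> {l \<in> {m..?K}. ?n l = ?n m}"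
    unfolding k'_def using m by (intro Max_in) auto
  then have k': "m \<le> k'" "k' \<le> ?K" "?n k' = ?n m" by auto
  have "k' \<in> change_indices N M d i \<union> {?K}"
  proof (cases "k' = ?K")
    case False
    have "?n (k' + 1) \<noteq> ?n m"
    proof
      assume "?n (k' + 1) = ?n m"
      then have "k' + 1 \<le> Max {l \<in> {m..?K}. ?n l = ?n m}"
        using k' False by (intro Max_ge) auto
      then show False by (simp add: k'_def)
    qed
    \<comment> \<open>Membership in S_i also needs 1 <= k' <= K - 1; the lower bound comes from
      \<open>k \<in> {1..m}\<close> and m <= k'.\<close>
    then show ?thesis using k' m False by (auto simp: change_indices_def)
  qed simp
  then have "z k' + (\<Sum>j\<in>?n k'. y j) \<ge> 1"
    using feas i unfolding CP1_feasible_def by blast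
  then have "z k' \<ge> 1" using uncovered k'(3) by simp
  \<comment> \<open>Downward induction from k', chaining z^n >= z^(n+1).\<close>
  moreover have "z l \<ge> z k'" if "l \<le> k'" "1 \<le> l" for l
    using that
  proof (induction rule: inc_induct)
    case (step n)
    then have "z n \<ge> z (n + 1)"
      using feas k' by (auto simp: CP1_feasible_def)
    then show ?case using step by simp
  qed simp
  moreover have "k \<le> k'" "1 \<le> k" using m k' by auto
  ultimately have "z k \<ge> 1" by (meson order_trans)
  moreover have "z k \<in> {0, 1}"
    using feas m by (auto simp: CP1_feasible_def)
  ultimately show ?thesis by auto
qed

lemma radius_le_CP1_objective:
  assumes "N \<ge> 1" "M \<ge> 1" and feas: "(y, z) \<in> CP1_feasible N M p d"
  shows "radius N d {j \<in> {1..M}. y j = 1} \<le> CP1_objective N M d (y, z)"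
proof -
  let ?J = "{j \<in> {1..M}. y j = 1}"
  note J = open_sites_feasible[OF feas]
  have y: "y \<in> {1..M} \<rightarrow>\<^sub>E {0, 1}" and z: "z \<in> {1..distK N M d} \<rightarrow>\<^sub>E {0, 1}"
    using feas by (auto simp: CP1_feasible_def)
  obtain m where m: "m \<le> distK N M d" "radius N d ?J = distD N M d m"
    using radius_eq_distD[OF assms(1,2) J] by metis
  obtain i j where ij: "i \<in> {1..N}" "radius N d ?J = d i j" "\<And>j'. j' \<in> ?J \<Longrightarrow> d i j \<le> d i j'"
    using radius_witness[OF assms(1) J, of d] by blast
  \<comment> \<open>Every open site is at distance at least D^m from the client attaining the
    radius, while near sites are strictly closer. For m = 0 the resulting claim on \<open>z\<close>
    is vacuous and the bound is just D^0.\<close>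
  have "y j' = 0" if j': "j' \<in> near_sites N M d i m" for j'
  proof -
    have "j' \<in> {1..M}" "d i j' < d i j"
      using j' ij(2) m(2) by (simp_all add: near_sites_def)
    then have "j' \<notin> ?J" using ij(3)[of j'] by linarith
    moreover have "y j' \<in> {0, 1}" using y \<open>j' \<in> {1..M}\<close> by (rule PiE_mem)
    ultimately show ?thesis using \<open>j' \<in> {1..M}\<close> by simp
  qed
  then have one: "\<And>k. k \<in> {1..m} \<Longrightarrow> z k = 1"
    using uncovered_forces_one[OF feas ij(1) m(1)] by blast
  have "z k \<ge> 0" if "k \<in> {1..distK N M d}" for k
    using PiE_mem[OF z that] by auto
  with one show ?thesis
    unfolding m(2) by (rule CP1_objective_ge[OF assms(1,2) m(1)])
qed

lemma CP1_feasible_of_sites: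
  assumes "N \<ge> 1" "M \<ge> 1" "distK N M d \<ge> 1" and J: "J \<in> pcenter_feasible M p"
  shows "\<exists>s\<in>CP1_feasible N M p d. CP1_objective N M d s = radius N d J"
proof -
  let ?K = "distK N M d"
  obtain m where m: "m \<le> ?K" "radius N d J = distD N M d m"
    using radius_eq_distD[OF assms(1,2) J] by metis
  \<comment> \<open>Indicators of \<open>J\<close> and of {1..m}, restricted to their index sets so
    that they are extensional as feasibility demands.\<close>
  define y where "y = (\<lambda>j\<in>{1..M}. if j \<in> J then 1 else 0 :: real)"
  define z where "z = (\<lambda>k\<in>{1..?K}. if k \<le> m then 1 else 0 :: real)"
  have JM: "J \<subseteq> {1..M}" "J \<noteq> {}" "card J \<le> p" "finite J"
    using J by (auto simp: pcenter_feasible_def intro: finite_subset)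
  have "{j \<in> {1..M}. y j = 1} = J" using JM by (auto simp: y_def)
  moreover have "(\<Sum>j=1..M. y j) = card {j \<in> {1..M}. y j = 1}"
    by (rule sum_binary_eq_card) (auto simp: y_def)
  ultimately have s: "(\<Sum>j=1..M. y j) = card J" by simp
  have "1 \<le> card J" using JM by (simp add: Suc_le_eq card_gt_0_iff)
  have cover: "1 \<le> z k + (\<Sum>j\<in>near_sites N M d i k. y j)"
    if "i \<in> {1..N}" "k \<in> {1..?K}" for i k
  proof -
    have y0: "y j \<ge> 0" if "j \<in> near_sites N M d i k" for j
      using that by (auto simp: y_def near_sites_def)
    show ?thesis
    proof (cases "k \<le> m")
      case True
      then show ?thesis using that sum_nonneg[OF y0] by (simp add: z_def)
    next
      case False
      \<comment> \<open>Beyond the threshold \<open>z k\<close> is 0, so an open site must cover the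
        client: one lies within D^m < D^k, hence in the strict near set, and contributes 1 to the
        sum.\<close>
      obtain j where j: "j \<in> J" "d i j \<le> radius N d J"
        using radius_covers[OF \<open>i \<in> {1..N}\<close> J] by metis
      have "distD N M d m < distD N M d k"
        using False that m distD_le_iff[OF assms(1,2), of k d m] by simp
      then have "j \<in> near_sites N M d i k"
        using j JM m by (auto simp: near_sites_def)
      moreover have "finite (near_sites N M d i k)" by (simp add: near_sites_def)
      ultimately have "y j \<le> (\<Sum>j\<in>near_sites N M d i k. y j)"
        using y0 by (intro member_le_sum) auto
      moreover have "y j = 1" using j JM by (auto simp: y_def)
      moreover have "z k = 0" using that False by (simp add: z_def)
      ultimately show ?thesis by simp
    qed
  qed
  have "change_indices N M d i \<union> {?K} \<subseteq> {1..?K}" for i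
    using assms(3) by (auto simp: change_indices_def)
  then have "\<forall>i\<in>{1..N}. \<forall>k\<in>change_indices N M d i \<union> {?K}.
      1 \<le> z k + (\<Sum>j\<in>near_sites N M d i k. y j)"
    using cover by blast
  moreover have "y \<in> {1..M} \<rightarrow>\<^sub>E {0, 1}" "z \<in> {1..?K} \<rightarrow>\<^sub>E {0, 1}"
    by (auto simp: y_def z_def)
  moreover have "\<forall>k\<in>{1..?K - 1}. z k \<ge> z (k + 1)"
    by (auto simp: z_def)
  ultimately have "(y, z) \<in> CP1_feasible N M p d"
    using s \<open>1 \<le> card J\<close> JM(3) by (simp add: CP1_feasible_def)
  moreover have "CP1_objective N M d (y, z) = radius N d J"
    unfolding m(2) using m(1) by (intro CP1_objective_threshold) (auto simp: z_def)
  ultimately show ?thesis by blast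
qed

theorem proposition2:
  fixes N M p :: nat and d :: "nat \<Rightarrow> nat \<Rightarrow> real"
  assumes "N \<ge> 1" and "M \<ge> 1" and "p \<ge> 1"
    and "\<forall>i\<in>{1..N}. \<forall>j\<in>{1..M}. d i j \<ge> 0"
    and "distK N M d \<ge> 1"
  shows "CP1_value N M p d = optimal_radius N M p d \<and>
    (\<forall>y z. CP1_optimal N M p d y z \<longrightarrow>
       pcenter_optimal N M p d {j \<in> {1..M}. y j = 1})"
proof -
  \<comment> \<open>The transfer map sends a solution of the program to its open sites.\<close>
  let ?g = "\<lambda>s. {j \<in> {1..M}. fst s j = (1::real)}"
  have down: "?g s \<in> pcenter_feasible M p \<and> radius N d (?g s) \<le> CP1_objective N M d s"
    if "s \<in> CP1_feasible N M p d" for s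
    using that open_sites_feasible radius_le_CP1_objective[OF assms(1,2)]
    by (cases s) auto
  have up: "\<exists>s\<in>CP1_feasible N M p d. CP1_objective N M d s \<le> radius N d J"
    if "J \<in> pcenter_feasible M p" for J
    using CP1_feasible_of_sites[OF assms(1,2,5) that] by force
  note transfer = min_problem_transfer[where g = ?g, OF finite_CP1_feasible
      finite_pcenter_feasible CP1_feasible_nonempty[OF assms(2,3,5)] down up]
  show ?thesis
    unfolding CP1_value_def optimal_radius_def CP1_optimal_def pcenter_optimal_def
    using transfer(1) transfer(2)[of "(y, z)" for y z] by simp
qed

end
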